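(* For every $\epsilon\geq 0$ there is an integer $n_0$ such that $f(n,3)\geq (0.34917-\epsilon)n$ for every integer $n\geq n_0$.
   Context: All graphs are finite, simple and undirected. For a bipartite graph $G$ with (fixed) partite sets $A$ and $B$, a bihole of order $k$ is an independent set $I$ of $G$ with $|I\cap A|=|I\cap B|=k$. For positive integers $n$ and $\Delta$, $f(n,\Delta)$ is the largest integer $k$ such that every bipartite graph $G$ with partite sets $A$ and $B$ such that $|A|=|B|=n$ and every vertex of $A$ has degree at most $\Delta$ in $G$ has a bihole of order $k$. *)

theory Defs
  imports Complex_Main
begin

definition bipartite_graph :: "'a set \<Rightarrow> 'a set \<Rightarrow> 'a set set \<Rightarrow> bool" where
  "bipartite_graph A B E \<longleftrightarrow>
     finite A \<and> finite B \<and> A \<inter> B = {} \<and> (\<forall>e\<in>E. \<exists>a\<in>A. \<exists>b\<in>B. e = {a, b})"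

definition vertex_degree :: "'a set set \<Rightarrow> 'a \<Rightarrow> nat" where
  "vertex_degree E v = card {e \<in> E. v \<in> e}"

definition independent_set :: "'a set \<Rightarrow> 'a set set \<Rightarrow> 'a set \<Rightarrow> bool" where
  "independent_set V E I \<longleftrightarrow> I \<subseteq> V \<and> (\<forall>e\<in>E. \<not> e \<subseteq> I)"

definition bihole :: "'a set \<Rightarrow> 'a set \<Rightarrow> 'a set set \<Rightarrow> nat \<Rightarrow> 'a set \<Rightarrow> bool" where
  "bihole A B E k I \<longleftrightarrow>
     independent_set (A \<union> B) E I \<and> card (I \<inter> A) = k \<and> card (I \<inter> B) = k"

definition all_have_bihole :: "'a itself \<Rightarrow> nat \<Rightarrow> nat \<Rightarrow> nat \<Rightarrow> bool" where
  "all_have_bihole _ n \<Delta> k \<longleftrightarrow>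
     (\<forall>(A :: 'a set) B E.
        bipartite_graph A B E \<and> card A = n \<and> card B = n \<and>
        (\<forall>a\<in>A. vertex_degree E a \<le> \<Delta>)
        \<longrightarrow> (\<exists>I. bihole A B E k I))"

text \<open>Finite graphs are taken with natural numbers as vertices; by
  \<open>all_have_bihole_transfer\<close> below this is no restriction. The maximum exists
  because order 0 always works and no order above \<open>n\<close> does
  (\<open>bihole_number_greatest\<close>).\<close>

definition bihole_number :: "nat \<Rightarrow> nat \<Rightarrow> nat" where
  "bihole_number n \<Delta> = (GREATEST k. all_have_bihole TYPE(nat) n \<Delta> k)"

lemma all_have_bihole_0: "all_have_bihole TYPE('a) n \<Delta> 0"
proof -
  have "bihole A B E 0 {}" if "bipartite_graph A B E" for A B :: "'a set" and E
    using that by (auto simp: bihole_def independent_set_def bipartite_graph_def)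
  then show ?thesis by (auto simp: all_have_bihole_def)
qed

lemma all_have_bihole_le:
  assumes "all_have_bihole TYPE(nat) n \<Delta> k" shows "k \<le> n"
proof -
  have "bipartite_graph {..<n} {n..<2*n} {}" "card {..<n} = n" "card {n..<2*n} = n"
    by (auto simp: bipartite_graph_def)
  moreover have "\<forall>a\<in>{..<n}. vertex_degree {} a \<le> \<Delta>"
    by (simp add: vertex_degree_def)
  ultimately obtain I where "bihole {..<n} {n..<2*n} {} k I"
    using assms unfolding all_have_bihole_def by blast
  then have "card (I \<inter> {..<n}) = k" by (simp add: bihole_def)
  moreover have "card (I \<inter> {..<n}) \<le> card {..<n}" by (intro card_mono) auto
  ultimately show ?thesis by simp
qed

lemma bihole_number_greatest:
  "all_have_bihole TYPE(nat) n \<Delta> (bihole_number n \<Delta>)"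
  "all_have_bihole TYPE(nat) n \<Delta> k \<Longrightarrow> k \<le> bihole_number n \<Delta>"
  unfolding bihole_number_def
  using GreatestI_nat[of "all_have_bihole TYPE(nat) n \<Delta>" 0 n]
    Greatest_le_nat[of "all_have_bihole TYPE(nat) n \<Delta>" k n]
    all_have_bihole_0 all_have_bihole_le by blast+

lemma all_have_bihole_transfer:
  assumes nat: "all_have_bihole TYPE(nat) n \<Delta> k"
  shows "all_have_bihole TYPE('a) n \<Delta> k"
  unfolding all_have_bihole_def
proof (intro allI impI, elim conjE)
  fix A B :: "'a set" and E
  assume g: "bipartite_graph A B E" and cA: "card A = n" and cB: "card B = n"
    and deg: "\<forall>a\<in>A. vertex_degree E a \<le> \<Delta>"
  from g have "finite (A \<union> B)" by (simp add: bipartite_graph_def)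
  then obtain h :: "'a \<Rightarrow> nat" where h: "inj_on h (A \<union> B)"
    using finite_imp_inj_to_nat_seg by blast
  have hA: "inj_on h A" and hB: "inj_on h B" using h by (auto simp: inj_on_Un)
  have EV: "e \<subseteq> A \<union> B" if "e \<in> E" for e
    using g that by (fastforce simp: bipartite_graph_def)
  have finE: "finite E"
    using EV \<open>finite (A \<union> B)\<close> by (meson PowI finite_Pow_iff finite_subset subsetI)
  let ?E = "image h ` E"
  have disj: "h ` A \<inter> h ` B = {}"
    using h g by (auto simp: inj_on_def bipartite_graph_def)
  have g': "bipartite_graph (h ` A) (h ` B) ?E"
    using g disj by (fastforce simp: bipartite_graph_def)
  have deg': "vertex_degree ?E (h a) \<le> \<Delta>" if a: "a \<in> A" for a
  proof -
    have "{e \<in> ?E. h a \<in> e} \<subseteq> image h ` {e \<in> E. a \<in> e}"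
      using EV h a by (fastforce simp: inj_on_def)
    then have "card {e \<in> ?E. h a \<in> e} \<le> card {e \<in> E. a \<in> e}"
      using finE by (intro surj_card_le) auto
    with deg a show ?thesis by (force simp: vertex_degree_def)
  qed
  have "card (h ` A) = n" "card (h ` B) = n"
    using cA cB hA hB by (auto simp: card_image)
  with g' deg' nat obtain I where I: "bihole (h ` A) (h ` B) ?E k I"
    unfolding all_have_bihole_def by blast
  define J where "J = {v \<in> A \<union> B. h v \<in> I}"
  have "h ` (J \<inter> A) = I \<inter> h ` A" "h ` (J \<inter> B) = I \<inter> h ` B"
    by (auto simp: J_def)
  moreover have "inj_on h (J \<inter> A)" "inj_on h (J \<inter> B)"
    using hA hB by (auto intro: inj_on_subset)
  ultimately have "card (J \<inter> A) = k" "card (J \<inter> B) = k"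
    using I by (metis bihole_def card_image)+
  moreover have "independent_set (A \<union> B) E J"
    using I by (fastforce simp: bihole_def independent_set_def J_def)
  ultimately show "\<exists>I. bihole A B E k I" by (auto simp: bihole_def)
qed

end

theory Submission
  imports Defs
begin

text \<open>
  Build the part of the bihole in \<open>B\<close> greedily: start with \<open>F = A\<close> and \<open>K = {}\<close>, and repeatedly
  move to \<open>K\<close> a vertex of \<open>B - K\<close> with the fewest neighbours in \<open>F\<close>, deleting these neighbours
  from \<open>F\<close>. By double counting, this number is at most the integer part of
  \<open>3 |F| / |B - K|\<close>. Hence, after giving up one vertex of \<open>A\<close>, every step costs at most two vertices
  of \<open>F\<close>; and once \<open>|K|\<close> exceeds \<open>n/4\<close>, with \<open>|F|\<close> about \<open>n/2\<close>, every step costs at most one.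
  The two cardinalities meet at about \<open>3n/8\<close>, and \<open>3/8 > 0.34917\<close>.
\<close>

definition separated :: "'a set set \<Rightarrow> 'a set \<Rightarrow> 'a set \<Rightarrow> bool" where
  "separated E F K \<longleftrightarrow> (\<forall>a\<in>F. \<forall>b\<in>K. {a, b} \<notin> E)"

text \<open>The map from \<open>b\<close> to \<open>{a, b}\<close> is injective into the edges at
  \<open>a\<close>. Finiteness of \<open>E\<close> matters, since \<open>card\<close> is 0 on
  infinite sets.\<close>

lemma card_neighbours_le_vertex_degree:
  assumes "bipartite_graph A B E" "S \<subseteq> B"
  shows "card {b \<in> S. {a, b} \<in> E} \<le> vertex_degree E a"
proof -
  have "finite (A \<union> B)" "\<forall>e\<in>E. e \<subseteq> A \<union> B"
    using assms(1) by (fastforce simp: bipartite_graph_def)+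
  then have "finite E"
    by (meson PowI finite_Pow_iff finite_subset subsetI)
  moreover have "inj_on (\<lambda>b. {a, b}) {b \<in> S. {a, b} \<in> E}"
    by (auto simp: inj_on_def doubleton_eq_iff)
  ultimately show ?thesis
    unfolding vertex_degree_def by (intro card_inj_on_le) auto
qed

text \<open>Otherwise at least \<open>Suc d * card S\<close> edges join \<open>F\<close> to
  \<open>S\<close>, while the degrees in \<open>A\<close> allow at most
  \<open>\<Delta> * card F\<close>.\<close>

lemma exists_vertex_few_neighbours:
  assumes "bipartite_graph A B E" "\<forall>a\<in>A. vertex_degree E a \<le> \<Delta>"
    and "F \<subseteq> A" "S \<subseteq> B" "\<Delta> * card F < Suc d * card S"
  shows "\<exists>b\<in>S. card {a \<in> F. {a, b} \<in> E} \<le> d"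
proof (rule ccontr)
  assume "\<not> ?thesis"
  then have large: "\<forall>b\<in>S. Suc d \<le> card {a \<in> F. {a, b} \<in> E}" by auto
  have fin: "finite F" "finite S"
    using assms by (auto simp: bipartite_graph_def intro: finite_subset)
  have "Suc d * card S \<le> (\<Sum>b\<in>S. card {a \<in> F. {a, b} \<in> E})"
    using sum_bounded_below[of S "Suc d" "\<lambda>b. card {a \<in> F. {a, b} \<in> E}"] large
    by (simp add: mult.commute)
  also have "\<dots> = (\<Sum>a\<in>F. card {b \<in> S. {a, b} \<in> E})"
    using sum_multicount_gen[of S F "\<lambda>b a. {a, b} \<in> E" "\<lambda>a. card {b \<in> S. {a, b} \<in> E}"] fin
    by auto
  also have "\<dots> \<le> card F * \<Delta>"
  proof -
    have "card {b \<in> S. {a, b} \<in> E} \<le> \<Delta>" if "a \<in> F" for a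
      using card_neighbours_le_vertex_degree[OF assms(1,4), of a] assms(2,3) that
      by (meson order_trans subsetD)
    then show ?thesis
      using sum_bounded_above[of F "\<lambda>a. card {b \<in> S. {a, b} \<in> E}" \<Delta>] by simp
  qed
  finally show False using assms(5) by (simp add: mult.commute)
qed

text \<open>Removing the neighbours of the chosen vertex costs at most \<open>d\<close>. Trimming
  further to exactly \<open>card F - d\<close> makes all later sizes predictable.\<close>

lemma separated_greedy_step:
  assumes "bipartite_graph A B E" "\<forall>a\<in>A. vertex_degree E a \<le> \<Delta>"
    and "F \<subseteq> A" "K \<subseteq> B" "separated E F K"
    and "\<Delta> * card F < Suc d * (card B - card K)"
  shows "\<exists>F' K'. F' \<subseteq> A \<and> K' \<subseteq> B \<and> separated E F' K' \<and>
           card F' = card F - d \<and> card K' = Suc (card K)"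
proof -
  have fin: "finite F" "finite K" "finite B"
    using assms by (auto simp: bipartite_graph_def intro: finite_subset)
  have "card (B - K) = card B - card K"
    using fin assms(4) by (simp add: card_Diff_subset)
  with assms obtain b where b: "b \<in> B - K" "card {a \<in> F. {a, b} \<in> E} \<le> d"
    using exists_vertex_few_neighbours[of A B E \<Delta> F "B - K" d] by (metis Diff_subset)
  have "card F - d \<le> card (F - {a \<in> F. {a, b} \<in> E})"
    using b fin by (subst card_Diff_subset) auto
  then obtain F' where F': "F' \<subseteq> F - {a \<in> F. {a, b} \<in> E}" "card F' = card F - d"
    by (meson obtain_subset_with_card_n)
  have "separated E F' (insert b K)"
    using assms(5) F'(1) by (auto simp: separated_def)
  moreover have "card (insert b K) = Suc (card K)" using b fin by simp
  ultimately show ?thesis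
    using F' b assms(3,4) by (intro exI[of _ F'] exI[of _ "insert b K"]) auto
qed

text \<open>As the sizes after \<open>t\<close> steps are known exactly, the condition for each step
  becomes pure arithmetic in \<open>t\<close>.\<close>

lemma separated_greedy_iterate:
  assumes "bipartite_graph A B E" "\<forall>a\<in>A. vertex_degree E a \<le> \<Delta>"
    and "F \<subseteq> A" "K \<subseteq> B" "separated E F K"
    and "\<And>t. t < s \<Longrightarrow> \<Delta> * (card F - d * t) < Suc d * (card B - (card K + t))"
  shows "\<exists>F' K'. F' \<subseteq> A \<and> K' \<subseteq> B \<and> separated E F' K' \<and>
           card F' = card F - d * s \<and> card K' = card K + s"
  using assms(6)
proof (induction s)
  case 0
  then show ?case using assms(3-5) by auto
next
  case (Suc s)
  then obtain F' K' where "F' \<subseteq> A" "K' \<subseteq> B" "separated E F' K'"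
    and c: "card F' = card F - d * s" "card K' = card K + s"
    by (metis less_Suc_eq)
  then obtain F'' K'' where "F'' \<subseteq> A" "K'' \<subseteq> B" "separated E F'' K''"
    "card F'' = card F' - d" "card K'' = Suc (card K')"
    using separated_greedy_step[OF assms(1,2), of F' K' d] Suc.prems[of s] by (metis lessI)
  then show ?case using c
    by (intro exI[of _ F''] exI[of _ K'']) (auto simp: algebra_simps)
qed

text \<open>Trim both sides to size \<open>k\<close>; an edge inside the union would have one end in
  \<open>F\<close> and the other in \<open>K\<close>.\<close>

lemma separated_imp_bihole:
  assumes "bipartite_graph A B E" "F \<subseteq> A" "K \<subseteq> B" "separated E F K"
    and "k \<le> card F" "k \<le> card K"
  shows "\<exists>I. bihole A B E k I"
proof -
  obtain F' K' where s: "F' \<subseteq> F" "card F' = k" "K' \<subseteq> K" "card K' = k"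
    using assms(5,6) by (meson obtain_subset_with_card_n)
  have "A \<inter> B = {}" using assms(1) by (simp add: bipartite_graph_def)
  then have "(F' \<union> K') \<inter> A = F'" "(F' \<union> K') \<inter> B = K'"
    using s assms(2,3) by auto
  moreover have "\<not> e \<subseteq> F' \<union> K'" if e: "e \<in> E" for e
  proof
    assume sub: "e \<subseteq> F' \<union> K'"
    obtain a b where ab: "a \<in> A" "b \<in> B" "e = {a, b}"
      using assms(1) e by (auto simp: bipartite_graph_def)
    then have "a \<in> F" "b \<in> K"
      using sub s assms(2,3) \<open>A \<inter> B = {}\<close> by auto
    with assms(4) e ab show False by (auto simp: separated_def)
  qed
  ultimately show ?thesis
    using s assms(2,3)
    by (intro exI[of _ "F' \<union> K'"]) (auto simp: bihole_def independent_set_def)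
qed

lemma all_have_bihole_3:
  assumes "8 * k + 24 \<le> 3 * n"
  shows "all_have_bihole TYPE('a) n 3 k"
  unfolding all_have_bihole_def
proof (intro allI impI, elim conjE)
  fix A B :: "'a set" and E
  assume g: "bipartite_graph A B E" and card: "card A = n" "card B = n"
    and deg: "\<forall>a\<in>A. vertex_degree E a \<le> 3"
  define s where "s = Suc (n div 4)"
  have s: "n < 4 * s" "4 * s \<le> n + 4" by (auto simp: s_def)
  \<comment> \<open>With all of \<open>A\<close>, the strict inequality for \<open>d = 2\<close>
    would fail at \<open>t = 0\<close>, reading \<open>3 * n < 3 * n\<close>.\<close>
  obtain F0 where F0: "F0 \<subseteq> A" "card F0 = n - 1"
    using obtain_subset_with_card_n[of "n - 1" A] card by auto
  have "\<exists>F K. F \<subseteq> A \<and> K \<subseteq> B \<and> separated E F K \<and>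
      card F = card F0 - 2 * s \<and> card K = card ({} :: 'a set) + s"
    by (rule separated_greedy_iterate[OF g deg])
      (use F0 card s assms in \<open>auto simp: separated_def\<close>)
  then obtain F1 K1 where 1: "F1 \<subseteq> A" "K1 \<subseteq> B" "separated E F1 K1"
    and c1: "card F1 = n - 1 - 2 * s" "card K1 = s"
    using F0 by auto
  \<comment> \<open>Now \<open>d = 1\<close>: the inequality 3(n - 1 - 2s - t) < 2(n - s - t)
    amounts to n < 4s + t + 3, whence the choice of \<open>s\<close> just above n/4.\<close>
  have "\<exists>F K. F \<subseteq> A \<and> K \<subseteq> B \<and> separated E F K \<and>
      card F = card F1 - 1 * (k - s) \<and> card K = card K1 + (k - s)"
    by (rule separated_greedy_iterate[OF g deg 1]) (use c1 card s assms in auto)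
  then obtain F2 K2 where 2: "F2 \<subseteq> A" "K2 \<subseteq> B" "separated E F2 K2"
    and c2: "card F2 = n - 1 - 2 * s - (k - s)" "card K2 = s + (k - s)"
    using c1 by auto
  \<comment> \<open>If k < s, the second phase is empty and n - 1 - 2s \<ge> n/2 - 3 \<ge> k.
    Otherwise 2k \<le> n - 1 - s follows from s \<le> n/4 + 1.\<close>
  have "k \<le> card F2" "k \<le> card K2" using c2 s assms by auto
  with separated_imp_bihole[OF g 2] show "\<exists>I. bihole A B E k I" .
qed

theorem theorem4:
  fixes \<epsilon> :: real
  assumes "\<epsilon> \<ge> 0"
  shows "\<exists>n\<^sub>0 :: nat. \<forall>n \<ge> n\<^sub>0. real (bihole_number n 3) \<ge> (0.34917 - \<epsilon>) * real n"
proof (intro exI allI impI)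
  fix n :: nat
  \<comment> \<open>The bound (3n - 31)/8 obtained below exceeds 0.34917 n from n = 151 on; 200 is a
    round choice.\<close>
  assume n: "200 \<le> n"
  define k where "k = (3 * n - 24) div 8"
  have "8 * k + 24 \<le> 3 * n" "3 * n \<le> 8 * k + 31" using n by (auto simp: k_def)
  then have "k \<le> bihole_number n 3" and k: "3 * real n \<le> 8 * real k + 31"
    using all_have_bihole_3 bihole_number_greatest(2) by (blast, linarith)
  then have "0.34917 * real n \<le> real (bihole_number n 3)" using n by simp
  moreover have "(0.34917 - \<epsilon>) * real n \<le> 0.34917 * real n"
    using assms by (intro mult_right_mono) auto
  ultimately show "(0.34917 - \<epsilon>) * real n \<le> real (bihole_number n 3)" by linarith
qed

end
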